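(* Let $h\in C^2(\mathbb{R}^n)$ and $\mu>0$. Let $f:\mathbb{R}^n\to\mathbb{R}$, $f(x)=h(x)+\mu\|x\|_1$, and $F:\mathbb{R}^n\times\mathbb{R}^n\to\mathbb{R}$, $F(a,b)=h(a^2-b^2)+\mu\sum_{i=1}^n(a_i^2+b_i^2)$. Then for all $(a,b)\in\mathbb{R}^n\times\mathbb{R}^n$, the following statements are equivalent: (i) The point $s:=a^2-b^2$ is a stationary point of $f$, $\min\{a^2,b^2\}=0$, and $\nabla^2h(s)_{II}\succeq 0$, where $I=\{i\in\{1,\dots,n\}: s_i\neq 0\}$. (ii) The point $(a,b)$ is a second-order stationary point of $F$.
   Context: For $a,b\in\mathbb{R}^n$, the notation $a^2$, $b^2$, $\min\{a^2,b^2\}$ denotes componentwise operations (vectors in $\mathbb{R}^n$). For a matrix $A\in\mathbb{R}^{n\times n}$ and $I\subseteq\{1,\dots,n\}$, $A_{II}$ is the submatrix with rows and columns indexed by $I$. A point $x$ is a stationary point of $f$ if $-\nabla h(x)\in\mu\,\partial\|x\|_1$, where $\partial\|x\|_1$ is the convex subdifferential of the $\ell_1$-norm at $x$. A second-order stationary point of $F$ is a point $(a,b)$ with $\nabla F(a,b)=0$ and $\nabla^2F(a,b)\succeq 0$. *)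

theory Defs
  imports "HOL-Analysis.Analysis"
begin

(* gradient and hessian are only meaningful where the function is once, respectively
   twice, differentiable; elsewhere they are unspecified. *)

definition gradient :: "('a::euclidean_space \<Rightarrow> real) \<Rightarrow> 'a \<Rightarrow> 'a" where
  "gradient f x = (THE D. GDERIV f x :> D)"

(* For u and v in Basis this is the (u, v) entry of the Hessian matrix of f at x, defined as
   the derivative (Jacobian) of the gradient. *)

definition hessian :: "('a::euclidean_space \<Rightarrow> real) \<Rightarrow> 'a \<Rightarrow> 'a \<Rightarrow> 'a \<Rightarrow> real" where
  "hessian f x u v = u \<bullet> frechet_derivative (gradient f) (at x) v"

definition C2 :: "('a::euclidean_space \<Rightarrow> real) \<Rightarrow> bool" where
  "C2 f \<longleftrightarrow> f differentiable_on UNIV \<and> gradient f differentiable_on UNIV \<and>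
     (\<forall>u\<in>Basis. \<forall>v\<in>Basis. continuous_on UNIV (\<lambda>x. hessian f x u v))"

(* Positive semidefiniteness of the submatrix of A with rows and columns indexed by the
   finite set I; values of A outside I \<times> I play no role. *)

definition psd_on :: "'i set \<Rightarrow> ('i \<Rightarrow> 'i \<Rightarrow> real) \<Rightarrow> bool" where
  "psd_on I A \<longleftrightarrow> (\<forall>i\<in>I. \<forall>j\<in>I. A i j = A j i) \<and>
     (\<forall>v. 0 \<le> (\<Sum>i\<in>I. \<Sum>j\<in>I. v i * A i j * v j))"

definition l1norm :: "real ^ 'n \<Rightarrow> real" where
  "l1norm x = (\<Sum>i\<in>UNIV. \<bar>x $ i\<bar>)"

definition subdifferential :: "('a::euclidean_space \<Rightarrow> real) \<Rightarrow> 'a \<Rightarrow> 'a set" where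
  "subdifferential \<phi> x = {g. \<forall>y. \<phi> y \<ge> \<phi> x + g \<bullet> (y - x)}"

(* Stationarity of f is defined through its splitting into a smooth part h and
   the l1 part, so the splitting is an argument of the predicate. *)

definition stationary_point ::
    "(real ^ 'n \<Rightarrow> real) \<Rightarrow> (real ^ 'n \<Rightarrow> real) \<Rightarrow> real \<Rightarrow> real ^ 'n \<Rightarrow> bool" where
  "stationary_point f h \<mu> x \<longleftrightarrow> f = (\<lambda>y. h y + \<mu> * l1norm y) \<and>
     - gradient h x \<in> (\<lambda>g. \<mu> *\<^sub>R g) ` subdifferential l1norm x"

definition second_order_stationary_point ::
    "('a::euclidean_space \<Rightarrow> real) \<Rightarrow> 'a \<Rightarrow> bool" where
  "second_order_stationary_point F p \<longleftrightarrow> gradient F p = 0 \<and> psd_on Basis (hessian F p)"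

end

theory Submission
  imports Defs
begin

text \<open>
  Write \<open>g\<close> and \<open>G\<close> for the gradient and the Hessian of \<open>h\<close> at \<open>s\<close>, and \<open>W (u, z) = 2 (a u - b z)\<close>
  with componentwise products. The Hessian form of \<open>F\<close> at \<open>(a, b)\<close> in direction \<open>(u, z)\<close> is
  \<open>W \<bullet> G W + 2 \<Sum>\<^sub>i ((\<mu> + g\<^sub>i) u\<^sub>i\<^sup>2 + (\<mu> - g\<^sub>i) z\<^sub>i\<^sup>2)\<close>, and \<open>\<nabla>F (a, b) = 0\<close> says that
  \<open>g\<^sub>i = -\<mu>\<close> where \<open>a\<^sub>i \<noteq> 0\<close> and \<open>g\<^sub>i = \<mu>\<close> where \<open>b\<^sub>i \<noteq> 0\<close>; in particular \<open>a\<^sub>i b\<^sub>i = 0\<close>. Where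
  \<open>a\<^sub>i = 0\<close> (or \<open>b\<^sub>i = 0\<close>), testing the form on the corresponding axis gives the remaining bounds
  \<open>\<bar>g\<^sub>i\<bar> \<le> \<mu>\<close> of stationarity. When \<open>a b = 0\<close>, \<open>W\<close> maps onto the vectors supported in the
  support of \<open>s\<close>, and preimages can be chosen on which the diagonal sum vanishes. Symmetry of
  the two Hessian forms transfers through \<open>W\<close> as well, so Schwarz's theorem is not needed.
\<close>

section \<open>Uniqueness and existence of gradients\<close>

lemma gradient_eqI: "GDERIV f x :> D \<Longrightarrow> gradient f x = D"
  unfolding gradient_def
proof (rule the_equality)
  fix E
  assume "GDERIV f x :> D" "GDERIV f x :> E"
  then have "(\<lambda>v. v \<bullet> D) = (\<lambda>v. v \<bullet> E)"
    unfolding gderiv_def by (rule has_derivative_unique)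
  then have "\<forall>v. v \<bullet> E = v \<bullet> D" by (simp add: fun_eq_iff)
  then show "E = D" by (simp only: vector_eq_ldot)
qed

text \<open>The derivative is a linear functional on a Euclidean space; its adjoint at
  \<open>1\<close> is the vector representing it.\<close>

lemma differentiable_imp_GDERIV_gradient:
  fixes f :: "'a::euclidean_space \<Rightarrow> real"
  assumes "f differentiable (at x)"
  shows "GDERIV f x :> gradient f x"
proof -
  obtain f' where f': "(f has_derivative f') (at x)"
    using assms by (auto simp: differentiable_def)
  then have "f' = (\<lambda>v. v \<bullet> adjoint f' 1)"
    by (simp add: fun_eq_iff adjoint_works has_derivative_linear)
  with f' have "GDERIV f x :> adjoint f' 1"
    by (simp add: gderiv_def)
  with gradient_eqI[OF this] show ?thesis by simp
qed

section \<open>Semidefinite matrices as quadratic forms\<close>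

text \<open>Bilinearity carries both symmetry and nonnegativity from the entries to all combinations
  of the \<open>e i\<close>; conversely each \<open>e i\<close> is itself such a combination. The
  family \<open>e\<close> is arbitrary so that one argument serves the full Hessian of
  \<open>F\<close> and the submatrix of the Hessian of \<open>h\<close>.\<close>

lemma psd_on_linear_iff:
  assumes "finite I" "linear G"
  shows "psd_on I (\<lambda>i j. e i \<bullet> G (e j)) \<longleftrightarrow>
    (\<forall>x\<in>range (\<lambda>v. \<Sum>i\<in>I. v i *\<^sub>R e i). 0 \<le> x \<bullet> G x \<and>
       (\<forall>y\<in>range (\<lambda>v. \<Sum>i\<in>I. v i *\<^sub>R e i). x \<bullet> G y = y \<bullet> G x))"
    (is "?psd \<longleftrightarrow> ?form")
proof
  have expand: "(\<Sum>i\<in>I. v i *\<^sub>R e i) \<bullet> G (\<Sum>i\<in>I. w i *\<^sub>R e i)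
      = (\<Sum>i\<in>I. \<Sum>j\<in>I. v i * (e i \<bullet> G (e j)) * w j)" for v w
    by (simp add: linear_sum[OF \<open>linear G\<close>] linear_cmul[OF \<open>linear G\<close>]
        inner_sum_left inner_sum_right mult_ac sum_distrib_left,
        rule sum.swap)
  {
    assume ?psd
    have "(\<Sum>i\<in>I. \<Sum>j\<in>I. v i * (e i \<bullet> G (e j)) * w j)
        = (\<Sum>i\<in>I. \<Sum>j\<in>I. w i * (e i \<bullet> G (e j)) * v j)" for v w
    proof -
      have "(\<Sum>i\<in>I. \<Sum>j\<in>I. v i * (e i \<bullet> G (e j)) * w j)
          = (\<Sum>i\<in>I. \<Sum>j\<in>I. w j * (e j \<bullet> G (e i)) * v i)"
        using \<open>?psd\<close> by (intro sum.cong refl) (auto simp: psd_on_def)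
      also have "\<dots> = (\<Sum>i\<in>I. \<Sum>j\<in>I. w i * (e i \<bullet> G (e j)) * v j)"
        by (rule sum.swap)
      finally show ?thesis .
    qed
    then show ?form
      using \<open>?psd\<close> by (auto simp: psd_on_def expand)
  next
    assume form: ?form
    have e: "e i \<in> range (\<lambda>v. \<Sum>i\<in>I. v i *\<^sub>R e i)" if "i \<in> I" for i
    proof -
      have "e i = (\<Sum>k\<in>I. (if k = i then 1 else 0) *\<^sub>R e k)"
        using that \<open>finite I\<close> by (simp add: if_distrib[of "\<lambda>c. c *\<^sub>R _"] cong: if_cong)
      then show ?thesis
        by (rule range_eqI[where x = "\<lambda>k. if k = i then 1 else 0"])
    qed
    show ?psd
      unfolding psd_on_def
    proof (intro conjI ballI allI)
      show "e i \<bullet> G (e j) = e j \<bullet> G (e i)" if "i \<in> I" "j \<in> I" for i j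
        using bspec[OF form e[OF that(1)]] e[OF that(2)] by (elim conjE bspec)
      show "0 \<le> (\<Sum>i\<in>I. \<Sum>j\<in>I. v i * (e i \<bullet> G (e j)) * v j)" for v
        using bspec[OF form rangeI[of _ v]] by (simp only: expand)
    qed
  }
qed

lemma psd_on_Basis_iff:
  fixes G :: "'a::euclidean_space \<Rightarrow> 'a"
  assumes "linear G"
  shows "psd_on Basis (\<lambda>u v. u \<bullet> G v) \<longleftrightarrow>
    (\<forall>x. 0 \<le> x \<bullet> G x \<and> (\<forall>y. x \<bullet> G y = y \<bullet> G x))"
proof -
  have "range (\<lambda>v. \<Sum>b\<in>Basis. v b *\<^sub>R b) = (UNIV :: 'a set)"
  proof (intro set_eqI iffI UNIV_I)
    fix x :: 'a
    show "x \<in> range (\<lambda>v. \<Sum>b\<in>Basis. v b *\<^sub>R b)"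
      by (rule range_eqI[of _ _ "\<lambda>b. x \<bullet> b"]) (simp add: euclidean_representation)
  qed
  with psd_on_linear_iff[OF finite_Basis assms, of "\<lambda>u. u"] show ?thesis by simp
qed

lemma psd_on_axis_iff:
  fixes G :: "real ^ 'n \<Rightarrow> real ^ 'n"
  assumes "linear G"
  shows "psd_on I (\<lambda>i j. axis i 1 \<bullet> G (axis j 1)) \<longleftrightarrow>
    (\<forall>x. (\<forall>i. i \<notin> I \<longrightarrow> x $ i = 0) \<longrightarrow> 0 \<le> x \<bullet> G x \<and>
       (\<forall>y. (\<forall>i. i \<notin> I \<longrightarrow> y $ i = 0) \<longrightarrow> x \<bullet> G y = y \<bullet> G x))"
proof -
  have "range (\<lambda>v. \<Sum>i\<in>I. v i *\<^sub>R (axis i 1 :: real ^ 'n)) = {x. \<forall>i. i \<notin> I \<longrightarrow> x $ i = 0}"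
  proof (intro set_eqI iffI)
    fix x :: "real ^ 'n"
    assume "x \<in> {x. \<forall>i. i \<notin> I \<longrightarrow> x $ i = 0}"
    then have "x = (\<Sum>i\<in>I. x $ i *\<^sub>R axis i 1)"
      by (auto simp: vec_eq_iff axis_def if_distrib[of "(*) _"] cong: if_cong)
    then show "x \<in> range (\<lambda>v. \<Sum>i\<in>I. v i *\<^sub>R axis i 1)"
      by (rule range_eqI[where x = "\<lambda>i. x $ i"])
  qed (auto simp: axis_def intro!: sum.neutral)
  with psd_on_linear_iff[OF finite assms, of I "\<lambda>i. axis i 1"] show ?thesis by auto
qed

section \<open>The subdifferential of the l1 norm and first-order stationarity\<close>

text \<open>The norm is a sum over coordinates, so its subdifferential is the product of those of
  the absolute value. The product equation encodes the sign condition where \<open>x $ i\<close> is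
  nonzero and is vacuous elsewhere.\<close>

lemma subdifferential_l1norm:
  "subdifferential l1norm x = {d. \<forall>i. \<bar>d $ i\<bar> \<le> 1 \<and> d $ i * x $ i = \<bar>x $ i\<bar>}"
proof (intro set_eqI iffI)
  fix d
  assume "d \<in> subdifferential l1norm x"
  then have sub: "l1norm x + d \<bullet> (y - x) \<le> l1norm y" for y
    by (simp add: subdifferential_def)
  have step: "\<bar>x $ i\<bar> + d $ i * t \<le> \<bar>x $ i + t\<bar>" for i t
  proof -
    have "l1norm (x + axis i t) - l1norm x = (\<Sum>j\<in>UNIV. if j = i then \<bar>x $ i + t\<bar> - \<bar>x $ i\<bar> else 0)"
      unfolding l1norm_def sum_subtractf[symmetric] by (intro sum.cong) (auto simp: axis_def)
    then show ?thesis
      using sub[of "x + axis i t"] by (simp add: inner_axis)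
  qed
  \<comment> \<open>With the triangle inequality, the steps 1 and -1 bound \<open>d $ i\<close>. The
    steps \<open>x $ i\<close> (doubling the coordinate) and \<open>- x $ i\<close> (moving it to 0)
    give the two halves of the equation.\<close>
  have "\<bar>d $ i\<bar> \<le> 1 \<and> d $ i * x $ i = \<bar>x $ i\<bar>" for i
    using step[of i 1] step[of i "- 1"] step[of i "x $ i"] step[of i "- x $ i"] by auto
  then show "d \<in> {d. \<forall>i. \<bar>d $ i\<bar> \<le> 1 \<and> d $ i * x $ i = \<bar>x $ i\<bar>}" by simp
next
  fix d
  assume "d \<in> {d. \<forall>i. \<bar>d $ i\<bar> \<le> 1 \<and> d $ i * x $ i = \<bar>x $ i\<bar>}"
  then have d: "\<bar>d $ i\<bar> \<le> 1" "d $ i * x $ i = \<bar>x $ i\<bar>" for i by auto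
  have dy: "d $ i * y $ i \<le> \<bar>y $ i\<bar>" for y i
  proof -
    have "d $ i * y $ i \<le> \<bar>d $ i\<bar> * \<bar>y $ i\<bar>" by (simp flip: abs_mult)
    also have "\<dots> \<le> \<bar>y $ i\<bar>" using d(1) by (simp add: mult_left_le_one_le)
    finally show ?thesis .
  qed
  have "\<bar>x $ i\<bar> + d $ i * (y $ i - x $ i) \<le> \<bar>y $ i\<bar>" for y i
    using d(2)[of i] dy[of i y] by (simp add: right_diff_distrib)
  then show "d \<in> subdifferential l1norm x"
    by (simp add: subdifferential_def l1norm_def inner_vec_def sum_mono flip: sum.distrib)
qed

lemma stationary_point_l1_iff:
  assumes "\<mu> > 0"
  shows "stationary_point (\<lambda>y. h y + \<mu> * l1norm y) h \<mu> x \<longleftrightarrow>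
    (\<forall>i. \<bar>gradient h x $ i\<bar> \<le> \<mu> \<and> gradient h x $ i * x $ i = - \<mu> * \<bar>x $ i\<bar>)"
proof -
  let ?g = "gradient h x"
  have "- ?g \<in> (\<lambda>d. \<mu> *\<^sub>R d) ` subdifferential l1norm x
      \<longleftrightarrow> - ?g /\<^sub>R \<mu> \<in> subdifferential l1norm x"
  proof
    assume "- ?g \<in> (\<lambda>d. \<mu> *\<^sub>R d) ` subdifferential l1norm x"
    then obtain d where "- ?g = \<mu> *\<^sub>R d" "d \<in> subdifferential l1norm x"
      by blast
    with assms show "- ?g /\<^sub>R \<mu> \<in> subdifferential l1norm x"
      by simp
  next
    assume "- ?g /\<^sub>R \<mu> \<in> subdifferential l1norm x"
    then show "- ?g \<in> (\<lambda>d. \<mu> *\<^sub>R d) ` subdifferential l1norm x"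
      using assms by (intro image_eqI[of _ _ "- ?g /\<^sub>R \<mu>"]) auto
  qed
  also have "\<dots> \<longleftrightarrow> (\<forall>i. \<bar>?g $ i\<bar> \<le> \<mu> \<and> ?g $ i * x $ i = - \<mu> * \<bar>x $ i\<bar>)"
  proof -
    have "\<bar>(- ?g /\<^sub>R \<mu>) $ i\<bar> \<le> 1 \<longleftrightarrow> \<bar>?g $ i\<bar> \<le> \<mu>"
      and "(- ?g /\<^sub>R \<mu>) $ i * x $ i = \<bar>x $ i\<bar> \<longleftrightarrow> ?g $ i * x $ i = - \<mu> * \<bar>x $ i\<bar>" for i
      using assms by (auto simp: abs_mult field_simps)
    then show ?thesis by (simp only: subdifferential_l1norm mem_Collect_eq)
  qed
  finally show ?thesis by (simp add: stationary_point_def)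
qed

section \<open>First and second derivatives of the lifted function\<close>

text \<open>Provides the product rule for componentwise multiplication.\<close>

lemma bounded_bilinear_vec_mult: "bounded_bilinear ((*) :: real ^ 'n \<Rightarrow> real ^ 'n \<Rightarrow> real ^ 'n)"
  unfolding bilinear_conv_bounded_bilinear[symmetric] bilinear_def
  by (auto intro!: linearI simp: vec_eq_iff algebra_simps)

lemmas has_derivative_vec_mult [derivative_intros] =
  bounded_bilinear.FDERIV[OF bounded_bilinear_vec_mult]

text \<open>Componentwise multiplication is self-adjoint; this is what isolates the direction when a
  gradient is read off a derivative.\<close>

lemma inner_vec_mult: "x \<bullet> (y * z) = (x * y) \<bullet> (z :: real ^ 'n)"
  by (simp add: inner_vec_def mult_ac)

lemma inner_vec_mult_swap: "(x * y) \<bullet> z = (x * z) \<bullet> (y :: real ^ 'n)"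
  by (simp add: inner_vec_def mult_ac)

definition square_diff :: "(real ^ 'n) \<times> (real ^ 'n) \<Rightarrow> real ^ 'n" where
  "square_diff p = fst p * fst p - snd p * snd p"

text \<open>The function \<open>F\<close> of the theorem, with its quadratic term written as the
  inner product of the product space so that its derivative is immediate.\<close>

definition lifted ::
    "(real ^ 'n \<Rightarrow> real) \<Rightarrow> real \<Rightarrow> (real ^ 'n) \<times> (real ^ 'n) \<Rightarrow> real" where
  "lifted h \<mu> p = h (square_diff p) + \<mu> * (p \<bullet> p)"

text \<open>The derivative at \<open>p\<close>, in direction \<open>v\<close>, of the gradient of
  \<open>lifted h \<mu>\<close>; by the chain rule, \<open>w\<close> is the resulting change of
  \<open>gradient h\<close>.\<close>

definition hessian_lifted ::
    "(real ^ 'n \<Rightarrow> real) \<Rightarrow> real \<Rightarrow> (real ^ 'n) \<times> (real ^ 'n) \<Rightarrow>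
      (real ^ 'n) \<times> (real ^ 'n) \<Rightarrow> (real ^ 'n) \<times> (real ^ 'n)" where
  "hessian_lifted h \<mu> p v =
    (let g = gradient h (square_diff p);
         w = frechet_derivative (gradient h) (at (square_diff p))
               (2 *\<^sub>R (fst p * fst v - snd p * snd v))
     in (2 *\<^sub>R (fst v * g + fst p * w + \<mu> *\<^sub>R fst v),
         2 *\<^sub>R (\<mu> *\<^sub>R snd v - (snd v * g + snd p * w))))"

lemma has_derivative_square_diff:
  "(square_diff has_derivative (\<lambda>v. 2 *\<^sub>R (fst p * fst v - snd p * snd v))) (at p)"
proof -
  have "(square_diff has_derivative (\<lambda>v. fst p * fst v + fst v * fst p - (snd p * snd v + snd v * snd p)))
      (at p)"
    unfolding square_diff_def[abs_def] by (intro derivative_intros)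
  moreover have "fst p * fst v + fst v * fst p - (snd p * snd v + snd v * snd p)
      = 2 *\<^sub>R (fst p * fst v - snd p * snd v)" for v
    by (simp add: vec_eq_iff)
  ultimately show ?thesis by simp
qed

lemma gradient_lifted:
  assumes "C2 h"
  shows "gradient (lifted h \<mu>) p =
    (2 *\<^sub>R (fst p * gradient h (square_diff p) + \<mu> *\<^sub>R fst p),
     2 *\<^sub>R (\<mu> *\<^sub>R snd p - snd p * gradient h (square_diff p)))"
proof (rule gradient_eqI)
  have "GDERIV h (square_diff p) :> gradient h (square_diff p)"
    using assms by (intro differentiable_imp_GDERIV_gradient) (auto simp: C2_def differentiable_on_def)
  then have h: "(h has_derivative (\<lambda>v. v \<bullet> gradient h (square_diff p))) (at (square_diff p))"
    by (simp add: gderiv_def)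
  have "(lifted h \<mu> has_derivative (\<lambda>v. (2 *\<^sub>R (fst p * fst v - snd p * snd v)) \<bullet>
      gradient h (square_diff p) + \<mu> * (p \<bullet> v + v \<bullet> p))) (at p)"
    unfolding lifted_def[abs_def]
    by (intro derivative_intros has_derivative_compose[OF has_derivative_square_diff h])
  moreover have "(2 *\<^sub>R (fst p * fst v - snd p * snd v)) \<bullet> gradient h (square_diff p)
      + \<mu> * (p \<bullet> v + v \<bullet> p) =
    v \<bullet> (2 *\<^sub>R (fst p * gradient h (square_diff p) + \<mu> *\<^sub>R fst p),
     2 *\<^sub>R (\<mu> *\<^sub>R snd p - snd p * gradient h (square_diff p)))" for v
    by (simp add: inner_prod_def inner_vec_mult inner_diff_left inner_diff_right inner_add_right
        inner_commute[of "fst p"] inner_commute[of "snd p"] mult.commute[of "fst p"]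
        mult.commute[of "snd p"] inner_vec_mult_swap[of _ "gradient h (square_diff p)"]
        right_diff_distrib distrib_left)
  ultimately show "GDERIV (lifted h \<mu>) p :>
    (2 *\<^sub>R (fst p * gradient h (square_diff p) + \<mu> *\<^sub>R fst p),
     2 *\<^sub>R (\<mu> *\<^sub>R snd p - snd p * gradient h (square_diff p)))"
    by (simp add: gderiv_def)
qed

lemma C2_has_derivative_gradient:
  assumes "C2 h"
  shows "(gradient h has_derivative frechet_derivative (gradient h) (at x)) (at x)"
  using assms by (simp add: C2_def differentiable_on_def frechet_derivative_works[symmetric])

lemma has_derivative_gradient_lifted:
  assumes "C2 h"
  shows "(gradient (lifted h \<mu>) has_derivative hessian_lifted h \<mu> p) (at p)"
proof -
  let ?w = "\<lambda>v. frechet_derivative (gradient h) (at (square_diff p))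
    (2 *\<^sub>R (fst p * fst v - snd p * snd v))"
  have "((\<lambda>p. gradient h (square_diff p)) has_derivative ?w) (at p)"
    by (rule has_derivative_compose[OF has_derivative_square_diff C2_has_derivative_gradient[OF assms]])
  then have "((\<lambda>p. (2 *\<^sub>R (fst p * gradient h (square_diff p) + \<mu> *\<^sub>R fst p),
      2 *\<^sub>R (\<mu> *\<^sub>R snd p - snd p * gradient h (square_diff p)))) has_derivative
    (\<lambda>v. (2 *\<^sub>R (fst p * ?w v + fst v * gradient h (square_diff p) + \<mu> *\<^sub>R fst v),
      2 *\<^sub>R (\<mu> *\<^sub>R snd v - (snd p * ?w v + snd v * gradient h (square_diff p)))))) (at p)"
    by (intro derivative_intros)
  then show ?thesis
    by (simp add: gradient_lifted[OF assms, abs_def] hessian_lifted_def[abs_def] Let_def add.commute)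
qed

text \<open>The factors \<open>a\<close> and \<open>- b\<close> in front of the derivative of
  \<open>gradient h\<close> move over to \<open>u\<close> and assemble there into the same linear
  map that is applied to \<open>v\<close>. All other terms are diagonal.\<close>

lemma hessian_lifted_form:
  "u \<bullet> hessian_lifted h \<mu> (a, b) v =
    (2 *\<^sub>R (a * fst u - b * snd u)) \<bullet>
      frechet_derivative (gradient h) (at (square_diff (a, b))) (2 *\<^sub>R (a * fst v - b * snd v))
    + 2 * (\<Sum>i\<in>UNIV. (\<mu> + gradient h (square_diff (a, b)) $ i) * (fst u $ i * fst v $ i)
                     + (\<mu> - gradient h (square_diff (a, b)) $ i) * (snd u $ i * snd v $ i))"
  unfolding hessian_lifted_def Let_def inner_prod_def inner_vec_def sum_distrib_left
    sum.distrib[symmetric]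
  by (rule sum.cong[OF refl]) (simp add: algebra_simps)

lemma second_order_stationary_point_lifted_iff:
  assumes "C2 h"
  shows "second_order_stationary_point (lifted h \<mu>) p \<longleftrightarrow>
    gradient (lifted h \<mu>) p = 0 \<and>
    (\<forall>u. 0 \<le> u \<bullet> hessian_lifted h \<mu> p u \<and> (\<forall>v. u \<bullet> hessian_lifted h \<mu> p v = v \<bullet> hessian_lifted h \<mu> p u))"
proof -
  have "frechet_derivative (gradient (lifted h \<mu>)) (at p) = hessian_lifted h \<mu> p"
    using frechet_derivative_at[OF has_derivative_gradient_lifted[OF assms]] by simp
  then show ?thesis
    using psd_on_Basis_iff[OF has_derivative_linear[OF has_derivative_gradient_lifted[OF assms]]]
    by (simp add: second_order_stationary_point_def hessian_def[abs_def])
qed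

section \<open>Equivalence of stationarity for \<open>f\<close> and second-order stationarity for
  \<open>F\<close>\<close>

theorem proposition3p1:
  fixes h f :: "real ^ 'n \<Rightarrow> real"
    and F :: "(real ^ 'n) \<times> (real ^ 'n) \<Rightarrow> real"
    and \<mu> :: real
    and a b s :: "real ^ 'n"
  assumes "C2 h"
    and "\<mu> > 0"
    and "f = (\<lambda>x. h x + \<mu> * l1norm x)"
    and "F = (\<lambda>(a, b). h (\<chi> i. (a $ i)\<^sup>2 - (b $ i)\<^sup>2)
                      + \<mu> * (\<Sum>i\<in>UNIV. (a $ i)\<^sup>2 + (b $ i)\<^sup>2))"
    and "s = (\<chi> i. (a $ i)\<^sup>2 - (b $ i)\<^sup>2)"
  shows "(stationary_point f h \<mu> s \<and>
          (\<chi> i. min ((a $ i)\<^sup>2) ((b $ i)\<^sup>2)) = 0 \<and>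
          psd_on {i. s $ i \<noteq> 0} (\<lambda>i j. hessian h s (axis i 1) (axis j 1)))
         \<longleftrightarrow> second_order_stationary_point F (a, b)"
proof -
  define g where "g = gradient h s"
  define G where "G = frechet_derivative (gradient h) (at s)"
  define W where "W = (\<lambda>u :: (real ^ 'n) \<times> (real ^ 'n). 2 *\<^sub>R (a * fst u - b * snd u))"
  define D where "D = (\<lambda>u v :: (real ^ 'n) \<times> (real ^ 'n).
    \<Sum>i\<in>UNIV. (\<mu> + g $ i) * (fst u $ i * fst v $ i) + (\<mu> - g $ i) * (snd u $ i * snd v $ i))"
  have s: "s = square_diff (a, b)"
    by (simp add: assms(5) square_diff_def vec_eq_iff power2_eq_square)
  have si: "s $ i = (a $ i)\<^sup>2 - (b $ i)\<^sup>2" for i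
    by (simp add: assms(5))
  have "F p = lifted h \<mu> p" for p
  proof -
    have "(\<chi> i. (fst p $ i)\<^sup>2 - (snd p $ i)\<^sup>2) = square_diff p"
      by (simp add: square_diff_def vec_eq_iff power2_eq_square)
    then show ?thesis
      by (simp add: assms(4) lifted_def case_prod_beta inner_prod_def inner_vec_def
          power2_eq_square sum.distrib)
  qed
  then have F: "F = lifted h \<mu>" ..
  have "linear G"
    unfolding G_def by (rule has_derivative_linear[OF C2_has_derivative_gradient[OF \<open>C2 h\<close>]])
  have form: "u \<bullet> hessian_lifted h \<mu> (a, b) v = W u \<bullet> G (W v) + 2 * D u v" for u v
    by (simp add: hessian_lifted_form W_def G_def D_def g_def s)
  have D_commute: "D u v = D v u" for u v
    by (simp add: D_def mult_ac)
  have W_nth: "W u $ i = 2 * (a $ i * fst u $ i - b $ i * snd u $ i)" for u i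
    by (simp add: W_def)
  have stat: "stationary_point f h \<mu> s \<longleftrightarrow>
      (\<forall>i. \<bar>g $ i\<bar> \<le> \<mu> \<and> g $ i * s $ i = - \<mu> * \<bar>s $ i\<bar>)"
    using stationary_point_l1_iff[OF \<open>\<mu> > 0\<close>] by (simp add: assms(3) g_def)
  have minzero: "(\<chi> i. min ((a $ i)\<^sup>2) ((b $ i)\<^sup>2)) = 0 \<longleftrightarrow> (\<forall>i. a $ i = 0 \<or> b $ i = 0)"
  proof -
    have "min ((a $ i)\<^sup>2) ((b $ i)\<^sup>2) = 0 \<longleftrightarrow> a $ i = 0 \<or> b $ i = 0" for i
      by (auto simp: min_def)
    then show ?thesis by (simp add: vec_eq_iff)
  qed
  have grad: "gradient F (a, b) = 0 \<longleftrightarrow>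
      (\<forall>i. (a $ i = 0 \<or> g $ i = - \<mu>) \<and> (b $ i = 0 \<or> g $ i = \<mu>))"
  proof -
    have "2 * (a $ i * g $ i) + 2 * (\<mu> * a $ i) = 0 \<longleftrightarrow> a $ i = 0 \<or> g $ i = - \<mu>" for i
    proof -
      have "2 * (a $ i * g $ i) + 2 * (\<mu> * a $ i) = 2 * (a $ i * (g $ i + \<mu>))"
        by (simp add: algebra_simps)
      then show ?thesis by (auto simp: add_eq_0_iff2)
    qed
    moreover have "\<mu> * b $ i - b $ i * g $ i = 0 \<longleftrightarrow> b $ i = 0 \<or> g $ i = \<mu>" for i
      by (auto simp: mult.commute)
    ultimately show ?thesis
      by (simp add: F gradient_lifted[OF \<open>C2 h\<close>] zero_prod_def vec_eq_iff g_def s all_conj_distrib)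
  qed
  have psd: "psd_on {i. s $ i \<noteq> 0} (\<lambda>i j. hessian h s (axis i 1) (axis j 1)) \<longleftrightarrow>
      (\<forall>x. (\<forall>i. s $ i = 0 \<longrightarrow> x $ i = 0) \<longrightarrow> 0 \<le> x \<bullet> G x \<and>
        (\<forall>y. (\<forall>i. s $ i = 0 \<longrightarrow> y $ i = 0) \<longrightarrow> x \<bullet> G y = y \<bullet> G x))"
    using psd_on_axis_iff[OF \<open>linear G\<close>, of "{i. s $ i \<noteq> 0}"] by (simp add: hessian_def G_def)
  \<comment> \<open>Since \<open>D\<close> is symmetric, its terms cancel from the symmetry
    condition, which becomes symmetry of \<open>G\<close> on the range of \<open>W\<close>.\<close>
  have second: "second_order_stationary_point F (a, b) \<longleftrightarrow> gradient F (a, b) = 0 \<and>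
      (\<forall>u. 0 \<le> W u \<bullet> G (W u) + 2 * D u u \<and> (\<forall>v. W u \<bullet> G (W v) = W v \<bullet> G (W u)))"
    by (simp add: F second_order_stationary_point_lifted_iff[OF \<open>C2 h\<close>] form D_commute)
  show ?thesis
  proof (intro iffI; (elim conjE)?)
    assume "stationary_point f h \<mu> s" "(\<chi> i. min ((a $ i)\<^sup>2) ((b $ i)\<^sup>2)) = 0"
      and psd_s: "psd_on {i. s $ i \<noteq> 0} (\<lambda>i j. hessian h s (axis i 1) (axis j 1))"
    then have g: "\<bar>g $ i\<bar> \<le> \<mu>" "g $ i * s $ i = - \<mu> * \<bar>s $ i\<bar>"
      and ab: "a $ i = 0 \<or> b $ i = 0" for i
      by (auto simp: stat minzero)
    \<comment> \<open>If \<open>a $ i\<close> is nonzero, then \<open>b $ i = 0\<close> and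
      \<open>s $ i\<close> is the positive number \<open>(a $ i)\<^sup>2\<close>, which cancels from
      \<open>g(2)\<close>. For \<open>gb\<close> the sign of \<open>s $ i\<close> is
      reversed.\<close>
    have ga: "a $ i = 0 \<or> g $ i = - \<mu>" for i
      using g(2)[of i] ab[of i] mult_right_cancel[of "(a $ i)\<^sup>2" "g $ i" "- \<mu>"]
      by (cases "a $ i = 0") (auto simp: si)
    have gb: "b $ i = 0 \<or> g $ i = \<mu>" for i
      using g(2)[of i] ab[of i] by (auto simp: si)
    \<comment> \<open>One of \<open>a $ i\<close>, \<open>b $ i\<close> vanishes, so
      \<open>s $ i = 0\<close> forces both to vanish.\<close>
    have supp: "W u $ i = 0" if "s $ i = 0" for u i
      using that ab[of i] by (auto simp: si W_nth)
    have D_nonneg: "0 \<le> D u u" for u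
    proof -
      have "0 \<le> \<mu> + g $ i" "0 \<le> \<mu> - g $ i" for i
        using g(1)[of i] by linarith+
      then show ?thesis
        unfolding D_def
        by (auto intro!: sum_nonneg add_nonneg_nonneg[OF mult_nonneg_nonneg mult_nonneg_nonneg])
    qed
    have G: "0 \<le> W u \<bullet> G (W u)" "W u \<bullet> G (W v) = W v \<bullet> G (W u)" for u v
      using psd_s[unfolded psd] supp by blast+
    show "second_order_stationary_point F (a, b)"
      unfolding second grad
    proof (intro conjI allI)
      show "0 \<le> W u \<bullet> G (W u) + 2 * D u u" for u
        using G(1)[of u] D_nonneg[of u] by linarith
    qed (fact ga gb G(2))+
  next
    assume sosp: "second_order_stationary_point F (a, b)"
    then have ga: "a $ i = 0 \<or> g $ i = - \<mu>" and gb: "b $ i = 0 \<or> g $ i = \<mu>"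
      and nonneg: "0 \<le> W u \<bullet> G (W u) + 2 * D u u"
      and sym: "W u \<bullet> G (W v) = W v \<bullet> G (W u)" for i u v
      unfolding second grad by blast+
    \<comment> \<open>Two nonzero entries would give \<open>- \<mu> = \<mu>\<close>.\<close>
    have ab: "a $ i = 0 \<or> b $ i = 0" for i
      using ga[of i] gb[of i] \<open>\<mu> > 0\<close> by auto
    have "- g $ i \<le> \<mu>" for i
    proof (cases "a $ i = 0")
      case True
      \<comment> \<open>Because \<open>a $ i = 0\<close>, \<open>W\<close> kills this direction and
        only the diagonal term \<open>\<mu> + g $ i\<close> survives in the form.\<close>
      have "W (axis i 1, 0) = 0"
        using True by (auto simp: vec_eq_iff W_nth axis_def)
      moreover have "D (axis i 1, 0) (axis i 1, 0) = \<mu> + g $ i"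
        by (simp add: D_def axis_def if_distrib[of "(*) _"] cong: if_cong)
      ultimately show ?thesis
        using nonneg[of "(axis i 1, 0)"] by simp
    qed (use ga[of i] in simp)
    moreover have "g $ i \<le> \<mu>" for i
    proof (cases "b $ i = 0")
      case True
      have "W (0, axis i 1) = 0"
        using True by (auto simp: vec_eq_iff W_nth axis_def)
      moreover have "D (0, axis i 1) (0, axis i 1) = \<mu> - g $ i"
        by (simp add: D_def axis_def if_distrib[of "(*) _"] cong: if_cong)
      ultimately show ?thesis
        using nonneg[of "(0, axis i 1)"] by simp
    qed (use gb[of i] in simp)
    moreover have "g $ i * s $ i = - \<mu> * \<bar>s $ i\<bar>" for i
      using ga[of i] gb[of i] ab[of i] by (auto simp: si)
    ultimately have "stationary_point f h \<mu> s"
      by (simp add: stat abs_le_iff)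
    moreover have "(\<chi> i. min ((a $ i)\<^sup>2) ((b $ i)\<^sup>2)) = 0"
      using ab by (simp add: minzero)
    moreover
    \<comment> \<open>Since \<open>x / 0 = 0\<close>, the section \<open>U\<close> of \<open>W\<close> is supported where the diagonal terms of \<open>D\<close> vanish.\<close>
    define U where "U = (\<lambda>x :: real ^ 'n.
      ((\<chi> i. x $ i / (2 * a $ i)) :: real ^ 'n, (\<chi> i. - x $ i / (2 * b $ i)) :: real ^ 'n))"
    \<comment> \<open>By \<open>ab\<close> at most one of the two quotients contributes at
      \<open>i\<close>, and it returns \<open>x $ i\<close>. If both denominators are 0, then
      \<open>s $ i = 0\<close> and the support condition gives \<open>x $ i = 0\<close>.\<close>
    have WU: "W (U x) = x" if "\<forall>i. s $ i = 0 \<longrightarrow> x $ i = 0" for x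
    proof -
      have "W (U x) $ i = x $ i" for i
        using that ab[of i] by (cases "a $ i = 0"; cases "b $ i = 0") (auto simp: W_nth U_def si)
      then show ?thesis by (simp add: vec_eq_iff)
    qed
    have DU: "D (U x) (U x) = 0" for x
    proof -
      have "(\<mu> + g $ i) * (x $ i / (2 * a $ i) * (x $ i / (2 * a $ i))) = 0"
        and "(\<mu> - g $ i) * (- x $ i / (2 * b $ i) * (- x $ i / (2 * b $ i))) = 0" for i
        using ga[of i] gb[of i] by auto
      then show ?thesis by (simp only: D_def U_def fst_conv snd_conv vec_lambda_beta
            add_0 sum.neutral_const)
    qed
    have "psd_on {i. s $ i \<noteq> 0} (\<lambda>i j. hessian h s (axis i 1) (axis j 1))"
      unfolding psd
    proof (intro allI impI conjI)
      fix x :: "real ^ 'n"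
      assume x: "\<forall>i. s $ i = 0 \<longrightarrow> x $ i = 0"
      show "0 \<le> x \<bullet> G x"
        using nonneg[of "U x"] by (simp add: DU WU[OF x])
      show "x \<bullet> G y = y \<bullet> G x" if y: "\<forall>i. s $ i = 0 \<longrightarrow> y $ i = 0" for y
        using sym[of "U x" "U y"] by (simp add: WU[OF x] WU[OF y])
    qed
    ultimately show "stationary_point f h \<mu> s \<and> (\<chi> i. min ((a $ i)\<^sup>2) ((b $ i)\<^sup>2)) = 0 \<and>
        psd_on {i. s $ i \<noteq> 0} (\<lambda>i j. hessian h s (axis i 1) (axis j 1))"
      by blast
  qed
qed

end
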